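(* Let $k$ be a field, let $H=\langle a_1,\dots,a_n\rangle$ be the numerical semigroup with unique minimal generating set $0<a_1<a_2<\cdots<a_n$, where $\gcd(a_1,\dots,a_n)=1$, and let $C$ be the conductor of $H$. Let $R=k[H]=k[t^{a_1},\dots,t^{a_n}]\subseteq k[t]$. Then $$\mathbf{ggl}(R)=C+a_1.$$
   Context: The conductor $C$ of $H$ is the smallest integer $n\in H$ such that every integer larger than $n$ is also in $H$. The ring $k[H]$ is positively graded by giving $t^a$ degree $a$. For a positively graded Noetherian $k$-algebra $R=\bigoplus_{i\ge 0}R_i$ with $R_0=k$, put $\mathfrak{m}_n=\bigoplus_{i\ge n}R_i$; the generalized graded length $\mathbf{ggl}(R)$ is the smallest positive integer $n$ for which $\mathfrak{m}_n$ is contained in the ideal generated by some homogeneous system of parameters of $R$. *)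

theory Defs
  imports
    "HOL-Algebra.Generated_Rings"
    "HOL-Library.Extended_Nat"
    "HOL-Computational_Algebra.Polynomial"
begin

section \<open>Graded rings, parameters and generalized graded length\<close>

text \<open>
  The Krull dimension is the supremum of the lengths of strictly ascending chains of prime ideals.
  The zero ring has value \<open>0\<close> here; it does not arise below, because the
  parameters are required to have positive degree.
\<close>

definition krull_dim :: "('a, 'b) ring_scheme \<Rightarrow> enat" where
  "krull_dim R = Sup {enat r | r. \<exists>P :: nat \<Rightarrow> 'a set.
     (\<forall>i\<le>r. primeideal (P i) R) \<and> (\<forall>i<r. P i \<subset> P (Suc i))}"

text \<open>
  In what follows \<open>G i\<close> is the component of degree \<open>i\<close> of a positively graded
  Noetherian algebra \<open>R\<close> over a field \<open>k\<close>, with \<open>G 0 = k\<close>.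
\<close>

definition homogeneous_sop ::
    "('a, 'b) ring_scheme \<Rightarrow> (nat \<Rightarrow> 'a set) \<Rightarrow> 'a list \<Rightarrow> bool" where
  "homogeneous_sop R G xs \<longleftrightarrow>
     (\<forall>x \<in> set xs. \<exists>i>0. x \<in> G i) \<and>
     enat (length xs) = krull_dim R \<and>
     krull_dim (R Quot (genideal R (set xs))) = 0"

definition graded_tail ::
    "('a, 'b) ring_scheme \<Rightarrow> (nat \<Rightarrow> 'a set) \<Rightarrow> nat \<Rightarrow> 'a set" where
  "graded_tail R G n =
     {finsum R f I | f I. finite I \<and> I \<subseteq> {n..} \<and> (\<forall>i\<in>I. f i \<in> G i)}"

definition ggl :: "('a, 'b) ring_scheme \<Rightarrow> (nat \<Rightarrow> 'a set) \<Rightarrow> nat" where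
  "ggl R G = (LEAST n. 0 < n \<and>
     (\<exists>xs. homogeneous_sop R G xs \<and> graded_tail R G n \<subseteq> genideal R (set xs)))"


section \<open>Numerical semigroups and their semigroup rings\<close>

inductive_set generated_semigroup :: "nat set \<Rightarrow> nat set" for A :: "nat set" where
  zero: "0 \<in> generated_semigroup A"
| incl: "a \<in> A \<Longrightarrow> a \<in> generated_semigroup A"
| add: "x \<in> generated_semigroup A \<Longrightarrow> y \<in> generated_semigroup A \<Longrightarrow>
        x + y \<in> generated_semigroup A"

definition minimal_generating_set :: "nat set \<Rightarrow> nat set \<Rightarrow> bool" where
  "minimal_generating_set A H \<longleftrightarrow>
     generated_semigroup A = H \<and> (\<forall>B. B \<subset> A \<longrightarrow> generated_semigroup B \<noteq> H)"

definition conductor :: "nat set \<Rightarrow> nat" where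
  "conductor H = (LEAST n. n \<in> H \<and> (\<forall>m>n. m \<in> H))"

text \<open>The polynomial ring \<open>k[t]\<close> as a ring in the sense of HOL-Algebra.\<close>

definition kt_ring :: "'k::field poly ring" where
  "kt_ring = \<lparr>carrier = UNIV, monoid.mult = (*), one = 1, zero = 0, add = (+)\<rparr>"

text \<open>
  The subalgebra of \<open>k[t]\<close> generated by the monomials \<open>t^a\<close> for \<open>a \<in> A\<close>, that is, the subring
  generated by these monomials and the constants.
\<close>

definition monomial_algebra :: "nat set \<Rightarrow> 'k::field poly ring" where
  "monomial_algebra A = kt_ring\<lparr>carrier :=
     generate_ring kt_ring
       (range (\<lambda>c. [:c:]) \<union> (\<lambda>a. Polynomial.monom 1 a) ` A)\<rparr>"

text \<open>The grading in which \<open>t^a\<close> has degree \<open>a\<close>.\<close>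

definition monomial_grading :: "nat set \<Rightarrow> nat \<Rightarrow> 'k::field poly set" where
  "monomial_grading A i = carrier (monomial_algebra A) \<inter> range (\<lambda>c. Polynomial.monom c i)"

lemma cring_kt_ring: "cring (kt_ring :: 'k::field poly ring)"
proof -
  have "\<exists>y. x + y = 0" for x :: "'k poly"
    by (rule exI[of _ "- x"]) simp
  then show ?thesis
    unfolding kt_ring_def
    by (intro cringI abelian_groupI comm_monoidI) (auto simp: algebra_simps)
qed

lemma uminus_kt_ring: "\<ominus>\<^bsub>kt_ring\<^esub> x = - (x :: 'k::field poly)"
proof -
  interpret cring "kt_ring :: 'k poly ring" by (rule cring_kt_ring)
  show ?thesis
    using minus_equality[of "- x" x] by (simp add: kt_ring_def)
qed

text \<open>
  The algebra generated by \<open>t^a\<close> for \<open>a \<in> A\<close> is the semigroup ring of the generated semigroup: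
  the polynomials all of whose exponents lie in it.
\<close>

lemma carrier_monomial_algebra:
  "carrier (monomial_algebra A :: 'k::field poly ring) =
     {p. \<forall>i. poly.coeff p i \<noteq> 0 \<longrightarrow> i \<in> generated_semigroup A}"
  (is "_ = ?S")
proof -
  let ?X = "range (\<lambda>c::'k. [:c:]) \<union> (\<lambda>a. Polynomial.monom 1 a) ` A"
  let ?G = "generate_ring kt_ring ?X"
  have add: "p + q \<in> ?G" if "p \<in> ?G" "q \<in> ?G" for p q
    using generate_ring.eng_add[OF that] by (simp add: kt_ring_def)
  have mult: "p * q \<in> ?G" if "p \<in> ?G" "q \<in> ?G" for p q
    using generate_ring.eng_mult[OF that] by (simp add: kt_ring_def)
  have const: "[:c:] \<in> ?G" for c
    by (rule generate_ring.incl) simp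
  have mon: "Polynomial.monom 1 i \<in> ?G" if "i \<in> generated_semigroup A" for i
    using that
  proof induction
    case zero
    then show ?case using const[of 1] by (simp add: one_pCons)
  next
    case (incl a)
    then show ?case by (intro generate_ring.incl) simp
  next
    case (add x y)
    then show ?case
      using mult[OF add.IH] by (simp add: mult_monom)
  qed
  have "p \<in> ?S" if "p \<in> ?G" for p
    using that
  proof induction
    case one
    then show ?case
      by (auto simp: kt_ring_def generated_semigroup.zero coeff_1 split: if_splits)
  next
    case (incl h)
    then show ?case
      by (auto simp: coeff_pCons split: nat.splits if_splits
          intro: generated_semigroup.intros)
  next
    case (a_inv h)
    then show ?case by (simp add: uminus_kt_ring)
  next
    case (eng_add p q)
    have "poly.coeff p i \<noteq> 0 \<or> poly.coeff q i \<noteq> 0" if "poly.coeff (p + q) i \<noteq> 0" for i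
      using that by auto
    then show ?case using eng_add.IH by (fastforce simp: kt_ring_def)
  next
    case (eng_mult p q)
    have "i \<in> generated_semigroup A" if nz: "poly.coeff (p * q) i \<noteq> 0" for i
    proof -
      from nz obtain j where j: "j \<le> i" "poly.coeff p j * poly.coeff q (i - j) \<noteq> 0"
        unfolding coeff_mult by (meson atMost_iff sum.neutral)
      then have "j \<in> generated_semigroup A" "i - j \<in> generated_semigroup A"
        using eng_mult.IH by auto
      from generated_semigroup.add[OF this] j(1) show ?thesis by simp
    qed
    then show ?case by (simp add: kt_ring_def)
  qed
  moreover have "p \<in> ?G" if p: "p \<in> ?S" for p
  proof -
    have term_in: "Polynomial.monom (poly.coeff p i) i \<in> ?G" for i
    proof (cases "poly.coeff p i = 0")
      case True
      then show ?thesis using const[of 0] by simp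
    next
      case False
      then have "[:poly.coeff p i:] * Polynomial.monom 1 i \<in> ?G"
        using p by (intro mult const mon) auto
      then show ?thesis by (simp add: smult_monom)
    qed
    have "(\<Sum>i\<in>I. Polynomial.monom (poly.coeff p i) i) \<in> ?G" if "finite I" for I
      using that
    proof induction
      case empty
      then show ?case using const[of 0] by simp
    next
      case (insert i I)
      then show ?case by (simp add: add term_in)
    qed
    then show ?thesis
      by (metis finite_atMost poly_as_sum_of_monoms)
  qed
  ultimately show ?thesis
    by (auto simp: monomial_algebra_def)
qed

end

theory Submission
  imports Defs
begin

text \<open>
  The ring \<open>R = k[H]\<close> is a one-dimensional domain in which \<^emph>\<open>every\<close> nonzero homogeneous element of
  positive degree is a system of parameters, so that computing \<open>ggl\<close> is a question about which
  translates \<open>h + H\<close> contain all large elements of \<open>H\<close>.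

  The semigroup \<open>H\<close> has a conductor because the generators have no common divisor
  (\<open>numerical_semigroup_cofinite\<close>). Hence \<open>t^C k[t] \<subseteq> R\<close>, and for a nonzero \<open>f \<in> R\<close> the ring
  \<open>R / f t^C k[t]\<close> is finite-dimensional over \<open>k\<close>: the powers of any \<open>g \<in> R\<close> satisfy a nontrivial
  linear relation modulo \<open>f\<close> (\<open>polynomial_relation_mod\<close>). Dividing such a relation by powers of
  \<open>g\<close> modulo a prime that contains \<open>f\<close> but not \<open>g\<close> makes \<open>g\<close> a unit modulo that prime.
  So nonzero primes are maximal (\<open>nonzero_prime_maximal\<close>), which gives
  dimension one for \<open>R\<close> and dimension zero for \<open>R/(x)\<close> whenever \<open>x \<noteq> 0\<close>.

  A homogeneous system of parameters is therefore a single monomial \<open>c t^h\<close> with \<open>0 < h \<in> H\<close> and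
  \<open>c \<noteq> 0\<close>, and \<open>t^i\<close> lies in the ideal generated by \<open>t^h\<close> iff \<open>i - h \<in> H\<close>. For \<open>h = a\<^sub>1\<close> this
  holds for all \<open>i \<ge> C + a\<^sub>1\<close>. Conversely, let \<open>C > 0\<close>. For any \<open>h\<close> it fails for
  \<open>i = C - 1 + h \<in> H\<close>, because \<open>C - 1\<close> is not in \<open>H\<close>; and \<open>C - 1 + h \<ge> C + a\<^sub>1 - 1\<close> because \<open>a\<^sub>1\<close> is
  the least positive element of \<open>H\<close>. If \<open>C = 0\<close>, then \<open>a\<^sub>1 = 1\<close> and the bound is trivial.
\<close>

section \<open>Numerical semigroups\<close>

lemma generated_semigroup_mult:
  "x \<in> generated_semigroup A \<Longrightarrow> q * x \<in> generated_semigroup A"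
  by (induction q) (auto intro: generated_semigroup.intros)

text \<open>
  The least positive difference \<open>d\<close> of two elements divides every element: otherwise a remainder
  modulo \<open>d\<close> would be a smaller difference. Hence \<open>d = 1\<close>, the semigroup contains two consecutive
  numbers \<open>y\<close> and \<open>y + 1\<close>, and every \<open>m \<ge> y\<^sup>2\<close> is a combination of these two.
\<close>

lemma numerical_semigroup_cofinite:
  assumes "Gcd A = (1::nat)"
  obtains N where "\<And>m. m \<ge> N \<Longrightarrow> m \<in> generated_semigroup A"
proof -
  let ?G = "generated_semigroup A"
  define diff where "diff d \<longleftrightarrow> 0 < d \<and> (\<exists>y\<in>?G. y + d \<in> ?G)" for d
  have "\<exists>x\<in>A. 0 < x"
  proof (rule ccontr)
    assume "\<not> ?thesis"
    then have "Gcd A = 0" by auto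
    with assms show False by simp
  qed
  then have "\<exists>d. diff d"
    unfolding diff_def using generated_semigroup.zero
    by (metis add_0 generated_semigroup.incl)
  then have d: "diff (LEAST d. diff d)" by (rule LeastI_ex)
  have least: "(LEAST d. diff d) \<le> e" if "diff e" for e using that by (rule Least_le)
  define d where "d = (LEAST d. diff d)"
  from d obtain y where y: "0 < d" "y \<in> ?G" "y + d \<in> ?G"
    unfolding d_def diff_def by blast
  have "d dvd x" if "x \<in> ?G" for x
  proof (rule ccontr)
    assume "\<not> d dvd x"
    then have "0 < x mod d" by (simp add: dvd_eq_mod_eq_0)
    moreover have "(x div d) * (y + d) \<in> ?G" "x + (x div d) * y \<in> ?G"
      using that y by (auto intro: generated_semigroup_mult generated_semigroup.add)
    moreover have "x + (x div d) * y = (x div d) * (y + d) + x mod d"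
    proof -
      have "x = (x div d) * d + x mod d" by simp
      then show ?thesis by (simp only: distrib_left)
    qed
    ultimately have "diff (x mod d)" unfolding diff_def by metis
    then have "d \<le> x mod d" using least by (simp add: d_def)
    with y(1) show False by (meson mod_less_divisor not_le)
  qed
  then have "d dvd Gcd A" by (auto intro!: Gcd_greatest generated_semigroup.incl)
  with assms have "d = 1" by simp
  with y have y1: "y + 1 \<in> ?G" by simp
  have "m \<in> ?G" if "m \<ge> y * y" for m
  proof (cases "y = 0")
    case True
    then show ?thesis using generated_semigroup_mult[OF y1, of m] by simp
  next
    case False
    then have "m mod y < y" by simp
    moreover have "y \<le> m div y"
      using that False by (simp add: less_eq_div_iff_mult_less_eq)
    ultimately have "m mod y \<le> m div y" by linarith
    then have "(m div y - m mod y) * y + (m mod y) * (y + 1) = (m div y) * y + m mod y"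
      by (simp add: distrib_left diff_mult_distrib mult_le_mono1)
    also have "\<dots> = m" by simp
    finally show ?thesis
      by (metis generated_semigroup.add generated_semigroup_mult y(2) y1)
  qed
  then show thesis by (rule that)
qed

lemma conductor_properties:
  assumes "Gcd A = (1::nat)"
  defines "C \<equiv> conductor (generated_semigroup A)"
  shows conductor_le_mem: "\<And>m. C \<le> m \<Longrightarrow> m \<in> generated_semigroup A"
    and pred_conductor_notin: "0 < C \<Longrightarrow> C - 1 \<notin> generated_semigroup A"
proof -
  let ?G = "generated_semigroup A"
  let ?P = "\<lambda>n. n \<in> ?G \<and> (\<forall>m>n. m \<in> ?G)"
  from numerical_semigroup_cofinite[OF assms(1)] obtain N where "\<And>m. m \<ge> N \<Longrightarrow> m \<in> ?G"
    by blast
  then have "?P N" by simp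
  then have C: "?P C" unfolding C_def conductor_def by (rule LeastI)
  then show "m \<in> ?G" if "C \<le> m" for m using that by (cases "m = C") auto
  show "C - 1 \<notin> ?G" if "0 < C"
  proof
    assume "C - 1 \<in> ?G"
    with C that have "?P (C - 1)" by (metis Suc_pred' less_antisym not_less_eq)
    then have "C \<le> C - 1" unfolding C_def conductor_def by (rule Least_le)
    with that show False by simp
  qed
qed

lemma generated_semigroup_ge:
  assumes "\<And>x. x \<in> A \<Longrightarrow> l \<le> x" "x \<in> generated_semigroup A" "0 < x"
  shows "l \<le> x"
  using assms(2,3) by induction (use assms(1) in fastforce)+


section \<open>Krull dimension of one-dimensional domains\<close>

lemma (in domain) krull_dim_eq_1:
  assumes maximal: "\<And>P Q. primeideal P R \<Longrightarrow> primeideal Q R \<Longrightarrow> P \<noteq> {\<zero>} \<Longrightarrow> \<not> P \<subset> Q"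
    and M: "primeideal M R" "M \<noteq> {\<zero>}"
  shows "krull_dim R = 1"
proof -
  let ?chain = "\<lambda>r P. (\<forall>i\<le>r. primeideal (P i) R) \<and> (\<forall>i<r. P i \<subset> P (Suc i))"
  let ?S = "{enat r | r. \<exists>P. ?chain r P}"
  have zero_in: "\<zero> \<in> P" if "primeideal P R" for P
    using that by (simp add: additive_subgroup.zero_closed ideal.axioms(1) primeideal.axioms(1))
  have le_1: "r \<le> 1" if "?chain r P" for r :: nat and P
  proof (rule ccontr)
    assume "\<not> r \<le> 1"
    with that have P: "primeideal (P 0) R" "primeideal (P 1) R" "primeideal (P 2) R"
      "P 0 \<subset> P 1" "P 1 \<subset> P 2"
      by (auto simp: numeral_2_eq_2 dest: spec[of _ 1])
    from P(4) zero_in[OF P(1)] have "P 1 \<noteq> {\<zero>}" by auto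
    then show False using maximal[OF P(2,3)] P(5) by simp
  qed
  have "?chain 1 (\<lambda>i. if i = 0 then {\<zero>} else M)"
    using M zero_in[OF M(1)] zeroprimeideal by auto
  then have "\<exists>P. ?chain 1 P" by (rule exI[of "?chain 1"])
  then have "1 \<in> ?S" by (intro CollectI exI[of _ 1] conjI) (simp_all only: one_enat_def)
  then have "1 \<le> Sup ?S" by (rule Sup_upper)
  moreover have "Sup ?S \<le> 1"
  proof (rule Sup_least, elim CollectE exE conjE)
    fix x r P assume "x = enat r" "\<forall>i\<le>r. primeideal (P i) R" "\<forall>i<r. P i \<subset> P (Suc i)"
    with le_1[of r P] show "x \<le> 1" by (simp add: one_enat_def)
  qed
  ultimately show ?thesis unfolding krull_dim_def by (rule antisym[rotated])
qed

text \<open>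
  A chain of primes in \<open>R/I\<close> pulls back to a chain of primes of \<open>R\<close> that contain \<open>I\<close>, and these are
  nonzero.
\<close>

lemma (in cring) krull_dim_Quot_eq_0:
  assumes maximal: "\<And>P Q. primeideal P R \<Longrightarrow> primeideal Q R \<Longrightarrow> P \<noteq> {\<zero>} \<Longrightarrow> \<not> P \<subset> Q"
    and I: "ideal I R" "I \<noteq> {\<zero>}"
  shows "krull_dim (R Quot I) = 0"
proof -
  have I_subgroup: "abelian_subgroup I R"
    using abelian_subgroupI3[OF ideal.axioms(1)[OF I(1)] is_abelian_group] .
  have surj: "\<exists>x\<in>carrier R. X = I +> x" if "X \<in> carrier (R Quot I)" for X
    using that unfolding FactRing_def A_RCOSETS_def' by simp
  let ?v = "\<lambda>P. {r \<in> carrier R. I +> r \<in> P}"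
  have length_0: "r = 0" if ch: "\<forall>i\<le>r. primeideal (P i) (R Quot I)" "\<forall>i<r. P i \<subset> P (Suc i)"
    for r :: nat and P
  proof (rule ccontr)
    assume "r \<noteq> 0"
    with ch have P: "primeideal (P 0) (R Quot I)" "primeideal (P 1) (R Quot I)" "P 0 \<subset> P 1"
      by auto
    interpret h: ring_hom_ring R "R Quot I" "(+>) I"
      using I(1) by (rule ideal.rcos_ring_hom_ring)
    have prime: "primeideal (?v (P 0)) R" "primeideal (?v (P 1)) R"
      using h.primeideal_vimage[OF is_cring P(1)] h.primeideal_vimage[OF is_cring P(2)] .
    have "\<zero>\<^bsub>R Quot I\<^esub> \<in> P 0"
      using additive_subgroup.zero_closed[OF ideal.axioms(1)[OF primeideal.axioms(1)[OF P(1)]]] .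
    then have "I \<in> P 0" unfolding FactRing_def by (simp only: ring.simps)
    have "x \<in> ?v (P 0)" if "x \<in> I" for x
    proof (intro CollectI conjI)
      show "x \<in> carrier R" using I(1) that by (rule ideal.Icarr)
      show "I +> x \<in> P 0"
        unfolding abelian_subgroup.a_rcos_const[OF I_subgroup that] by fact
    qed
    then have "I \<subseteq> ?v (P 0)" by (rule subsetI)
    moreover have "\<zero> \<in> I"
      using additive_subgroup.zero_closed[OF ideal.axioms(1)[OF I(1)]] .
    ultimately have nonzero: "?v (P 0) \<noteq> {\<zero>}" using I(2) by auto
    obtain X where X: "X \<in> P 1" "X \<notin> P 0" using P(3) by (elim psubsetE) auto
    have "X \<in> carrier (R Quot I)" using ideal.Icarr[OF primeideal.axioms(1)[OF P(2)] X(1)] .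
    then obtain x where x: "x \<in> carrier R" "X = I +> x"
      by (rule bexE[OF surj])
    have "?v (P 0) \<subseteq> ?v (P 1)" using P(3) by (elim psubsetE) blast
    moreover have "?v (P 0) \<noteq> ?v (P 1)"
    proof
      assume eq: "?v (P 0) = ?v (P 1)"
      have "x \<in> ?v (P 1)" using x(1) X(1) unfolding x(2) by (intro CollectI conjI)
      then have "x \<in> ?v (P 0)" unfolding eq .
      then show False using X(2) unfolding x(2) by (elim CollectE conjE notE)
    qed
    ultimately have "?v (P 0) \<subset> ?v (P 1)" by (rule psubsetI)
    with maximal[OF prime nonzero] show False by (rule notE)
  qed
  have "krull_dim (R Quot I) \<le> 0"
    unfolding krull_dim_def
  proof (rule Sup_least, elim CollectE exE conjE)
    fix x r P
    assume "x = enat r" "\<forall>i\<le>r. primeideal (P i) (R Quot I)" "\<forall>i<r. P i \<subset> P (Suc i)"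
    with length_0[of r P] show "x \<le> 0" by (simp add: zero_enat_def)
  qed
  then show ?thesis by simp
qed


section \<open>Relations between the powers of a polynomial modulo another one\<close>

lemma pcompose_monom: "pcompose (Polynomial.monom c n) g = smult c (g ^ n)"
  by (induction n) (simp_all add: monom_0 monom_Suc pcompose_pCons)

text \<open>
  The residues \<open>g^i mod F\<close> for \<open>i \<le> degree F\<close> are one more than the dimension of the space of
  polynomials of degree below \<open>degree F\<close>. So either two of them coincide, or they form a linearly
  dependent set; \<open>\<phi>\<close> has the coefficients of the resulting relation.
\<close>

lemma polynomial_relation_mod:
  fixes F g :: "'k::field poly"
  assumes "F \<noteq> 0"
  obtains \<phi> where "\<phi> \<noteq> 0" "F dvd pcompose \<phi> g"
proof -
  interpret vs: vector_space "smult :: 'k \<Rightarrow> 'k poly \<Rightarrow> 'k poly"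
    by unfold_locales (auto simp: smult_add_right smult_add_left)
  define d where "d = degree F"
  define v where "v = (\<lambda>i. g ^ i mod F)"
  show thesis
  proof (cases "inj_on v {..d}")
    case False
    then obtain i j where ij: "i \<noteq> j" "g ^ i mod F = g ^ j mod F"
      by (auto simp: inj_on_def v_def)
    define \<phi> :: "'k poly" where "\<phi> = Polynomial.monom 1 i - Polynomial.monom 1 j"
    have "poly.coeff \<phi> i = 1" using ij(1) by (simp add: \<phi>_def)
    then have "\<phi> \<noteq> 0" by auto
    moreover have "F dvd pcompose \<phi> g"
      using ij(2) by (simp add: \<phi>_def pcompose_diff pcompose_monom mod_eq_dvd_iff)
    ultimately show thesis by (rule that)
  next
    case True
    let ?B = "Polynomial.monom (1::'k) ` {..<d}"
    have "v i \<in> vs.span ?B" for i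
    proof -
      have *: "poly.coeff (v i) j = 0" if "j \<ge> d" for j
        using degree_mod_less[OF assms, of "g ^ i"] that
        by (auto simp: v_def d_def intro: coeff_eq_0)
      then have "v i = (\<Sum>j<d. smult (poly.coeff (v i) j) (Polynomial.monom 1 j))"
        by (intro poly_eqI) (auto simp: coeff_sum smult_monom not_less)
      also have "\<dots> \<in> vs.span ?B"
        by (intro vs.span_sum vs.span_scale vs.span_base) auto
      finally show ?thesis .
    qed
    moreover have "card ?B \<le> d" by (metis card_image_le card_lessThan finite_lessThan)
    moreover have "card (v ` {..d}) = Suc d" using True by (simp add: card_image)
    ultimately have "vs.dependent (v ` {..d})"
      using vs.independent_span_bound[of ?B "v ` {..d}"] by fastforce
    then obtain u where u: "\<exists>x\<in>v ` {..d}. u x \<noteq> 0" "(\<Sum>x\<in>v ` {..d}. smult (u x) x) = 0"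
      by (auto simp: vs.dependent_finite)
    define \<phi> where "\<phi> = (\<Sum>i\<le>d. Polynomial.monom (u (v i)) i)"
    from u(1) obtain i where "i \<le> d" "u (v i) \<noteq> 0" by auto
    then have "poly.coeff \<phi> i \<noteq> 0" by (simp add: \<phi>_def coeff_sum)
    then have "\<phi> \<noteq> 0" by auto
    have "pcompose \<phi> g mod F = (\<Sum>i\<le>d. smult (u (v i)) (g ^ i) mod F) mod F"
      by (simp add: \<phi>_def pcompose_sum pcompose_monom mod_sum_eq)
    also have "(\<Sum>i\<le>d. smult (u (v i)) (g ^ i) mod F) = (\<Sum>x\<in>v ` {..d}. smult (u x) x)"
      using True by (simp add: sum.reindex mod_smult_left v_def)
    finally have "F dvd pcompose \<phi> g" using u(2) by (simp add: mod_eq_0_iff_dvd)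
    with \<open>\<phi> \<noteq> 0\<close> show thesis by (rule that)
  qed
qed


section \<open>Semigroup rings and their nonzero primes\<close>

context
  fixes A :: "nat set" and R :: "'k::field poly ring"
  defines "R \<equiv> monomial_algebra A"
begin

lemma monomial_algebra_sel [simp]:
  "x \<otimes>\<^bsub>R\<^esub> y = x * y" "x \<oplus>\<^bsub>R\<^esub> y = x + y" "\<one>\<^bsub>R\<^esub> = 1" "\<zero>\<^bsub>R\<^esub> = 0"
  by (simp_all add: R_def monomial_algebra_def kt_ring_def)

lemma mem_carrier_iff:
  "p \<in> carrier R \<longleftrightarrow> (\<forall>i. poly.coeff p i \<noteq> 0 \<longrightarrow> i \<in> generated_semigroup A)"
  by (simp add: R_def carrier_monomial_algebra)

lemma mem_monomial_grading_iff:
  "p \<in> monomial_grading A i \<longleftrightarrow> p \<in> carrier R \<and> (\<exists>c. p = Polynomial.monom c i)"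
  by (auto simp: monomial_grading_def R_def)

lemma const_mem_carrier: "[:c:] \<in> carrier R"
  by (auto simp: mem_carrier_iff coeff_pCons generated_semigroup.zero split: nat.splits)

lemma domain_monomial_algebra: "domain R"
proof -
  have "domain (kt_ring :: 'k poly ring)"
    by (intro domain.intro domain_axioms.intro cring_kt_ring) (auto simp: kt_ring_def)
  then show ?thesis
    unfolding R_def monomial_algebra_def
    by (rule domain.subring_is_domain)
      (rule ring.generate_ring_is_subring[OF cring.axioms(1)[OF cring_kt_ring]],
        simp add: kt_ring_def)
qed

interpretation domain R by (rule domain_monomial_algebra)

lemma pcompose_mem_carrier: "g \<in> carrier R \<Longrightarrow> pcompose \<phi> g \<in> carrier R"
proof (induction \<phi>)
  case (pCons c \<phi>)
  then have "[:c:] \<oplus>\<^bsub>R\<^esub> g \<otimes>\<^bsub>R\<^esub> pcompose \<phi> g \<in> carrier R"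
    using const_mem_carrier by blast
  then show ?case by (simp add: pcompose_pCons)
qed (use zero_closed in simp)

text \<open>
  Powers of \<open>g\<close> can be cancelled from a relation modulo a prime that does not contain \<open>g\<close>, so
  the relation may be assumed to have a nonzero constant term.
\<close>

lemma relation_with_const_term:
  assumes P: "primeideal P R" and g: "g \<in> carrier R" "g \<notin> P"
    and "\<phi> \<noteq> 0" "pcompose \<phi> g \<in> P"
  shows "\<exists>c h. c \<noteq> 0 \<and> h \<in> carrier R \<and> [:c:] + g * h \<in> P"
  using assms(4,5)
proof (induction \<phi>)
  case (pCons c \<phi>)
  show ?case
  proof (cases "c = 0")
    case False
    then show ?thesis
      using pCons.prems pcompose_mem_carrier[OF g(1)] by (auto simp: pcompose_pCons)
  next
    case True
    with pCons.prems have "g \<otimes>\<^bsub>R\<^esub> pcompose \<phi> g \<in> P" by (simp add: pcompose_pCons)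
    then have "pcompose \<phi> g \<in> P"
      using primeideal.I_prime[OF P g(1) pcompose_mem_carrier[OF g(1)]] g(2) by blast
    with pCons True show ?thesis by auto
  qed
qed simp

lemma prime_contains_no_const:
  assumes "primeideal Q R" "c \<noteq> 0"
  shows "[:c:] \<notin> Q"
proof
  assume "[:c:] \<in> Q"
  moreover have "ideal Q R" using assms(1) by (rule primeideal.axioms(1))
  ultimately have "[:c:] \<otimes>\<^bsub>R\<^esub> [:inverse c:] \<in> Q"
    using const_mem_carrier ideal.I_r_closed by metis
  then have "\<one>\<^bsub>R\<^esub> \<in> Q" using assms(2) by (simp add: one_pCons)
  then have "Q = carrier R" using \<open>ideal Q R\<close> ideal.one_imp_carrier by blast
  then show False using primeideal.I_notcarr[OF assms(1)] by simp
qed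

text \<open>
  The homogeneous maximal ideal: it is the kernel of evaluation at \<open>t = 0\<close>, and with the zero ideal it
  forms a chain of primes of length one.
\<close>

lemma primeideal_vanishing_at_0: "primeideal {p \<in> carrier R. poly.coeff p 0 = 0} R"
proof (rule primeidealI)
  let ?M = "{p \<in> carrier R. poly.coeff p 0 = 0}"
  have neg: "\<ominus>\<^bsub>R\<^esub> x = - x" if "x \<in> carrier R" for x
    using r_neg[OF that] by (simp add: add_eq_0_iff)
  show "ideal ?M R"
  proof (rule idealI[OF ring_axioms])
    show "subgroup ?M (add_monoid R)"
    proof (rule add.subgroupI)
      show "\<ominus>\<^bsub>R\<^esub> x \<in> ?M" if "x \<in> ?M" for x
        using that a_inv_closed[of x] neg[of x] by auto
      show "x \<oplus>\<^bsub>R\<^esub> y \<in> ?M" if "x \<in> ?M" "y \<in> ?M" for x y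
        using that a_closed[of x y] by auto
    qed (use zero_closed in auto)
    show "x \<otimes>\<^bsub>R\<^esub> y \<in> ?M" "y \<otimes>\<^bsub>R\<^esub> x \<in> ?M" if "y \<in> ?M" "x \<in> carrier R" for x y
      using that m_closed[of x y] by (auto simp: coeff_mult_0 mult.commute)
  qed
  have "1 \<in> carrier R" "1 \<notin> ?M" using one_closed by simp_all
  then show "carrier R \<noteq> ?M" by blast
  show "x \<in> ?M \<or> y \<in> ?M" if "x \<in> carrier R" "y \<in> carrier R" "x \<otimes>\<^bsub>R\<^esub> y \<in> ?M" for x y
    using that by (auto simp: coeff_mult_0)
qed (rule is_cring)

lemma genideal_singleton:
  assumes "x \<in> carrier R"
  shows "genideal R {x} = {r * x | r. r \<in> carrier R}"
  using cgenideal_eq_genideal[OF assms] by (simp add: cgenideal_def)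

lemma coeff_graded_tail:
  assumes "p \<in> graded_tail R (monomial_grading A) n"
  shows "p \<in> carrier R" and "i < n \<Longrightarrow> poly.coeff p i = 0"
proof -
  from assms obtain f I where p: "p = finsum R f I" "finite I" "I \<subseteq> {n..}"
    and f: "\<And>i. i \<in> I \<Longrightarrow> f i \<in> monomial_grading A i"
    by (auto simp: graded_tail_def)
  have f': "f i \<in> carrier R" if "i \<in> I" for i
    using f[OF that] by (simp add: mem_monomial_grading_iff)
  have "finsum R f J \<in> carrier R \<and> (\<forall>i<n. poly.coeff (finsum R f J) i = 0)" if "J \<subseteq> I" for J
    using finite_subset[OF that p(2)] that
  proof (induction J)
    case (insert j J)
    have "finsum R f (insert j J) = f j + finsum R f J"
      using insert.hyps insert.prems f' by (subst finsum_insert) auto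
    moreover have "poly.coeff (f j) i = 0" if "i < n" for i
    proof -
      obtain c where "f j = Polynomial.monom c j"
        using f[of j] insert.prems by (auto simp: mem_monomial_grading_iff)
      then show ?thesis using insert.prems p(3) that by auto
    qed
    ultimately show ?case using insert a_closed[of "f j" "finsum R f J"] f' by simp
  qed (use zero_closed in simp)
  from this[of I] show "p \<in> carrier R" "i < n \<Longrightarrow> poly.coeff p i = 0" by (auto simp: p)
qed

lemma monom_mem_graded_tail:
  assumes "i \<in> generated_semigroup A" "n \<le> i"
  shows "Polynomial.monom 1 i \<in> graded_tail R (monomial_grading A) n"
proof -
  have "Polynomial.monom 1 i \<in> carrier R" using assms(1) by (simp add: mem_carrier_iff)
  then have "finsum R (\<lambda>_. Polynomial.monom 1 i) {i} = Polynomial.monom 1 i"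
    "Polynomial.monom (1::'k) i \<in> monomial_grading A i"
    using finsum_insert[of "{}" i "\<lambda>_. Polynomial.monom 1 i"]
    by (auto simp: mem_monomial_grading_iff)
  then show ?thesis
    unfolding graded_tail_def using assms(2)
    by (intro CollectI exI[of _ "\<lambda>_. Polynomial.monom 1 i"] exI[of _ "{i}"]) auto
qed

context
  fixes C :: nat
  assumes gcd: "Gcd A = 1" and C: "C = conductor (generated_semigroup A)"
begin

text \<open>Above the conductor there is no restriction on exponents: \<open>t^C k[t] \<subseteq> R\<close>.\<close>

lemma monom_conductor_mult_mem: "Polynomial.monom 1 C * q \<in> carrier R"
  using conductor_le_mem[OF gcd] by (auto simp: mem_carrier_iff coeff_monom_mult C split: if_splits)

text \<open>
  Let \<open>0 \<noteq> f \<in> P\<close> and \<open>g \<in> Q - P\<close>. The relation for \<open>g\<close> is taken modulo \<open>f t^C\<close> rather than \<open>f\<close>,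
  because divisibility by \<open>f t^C\<close> in \<open>k[t]\<close> implies divisibility by \<open>f\<close> in \<open>R\<close>. Its
  nonzero constant term is then a unit in \<open>Q\<close>.
\<close>

lemma nonzero_prime_maximal:
  assumes P: "primeideal P R" and Q: "primeideal Q R" and "P \<noteq> {\<zero>\<^bsub>R\<^esub>}"
  shows "\<not> P \<subset> Q"
proof
  assume "P \<subset> Q"
  have ideal: "ideal P R" "ideal Q R" using P Q by (auto intro: primeideal.axioms(1))
  have "\<zero>\<^bsub>R\<^esub> \<in> P"
    using ideal(1) by (simp add: additive_subgroup.zero_closed ideal.axioms(1) del: monomial_algebra_sel)
  with assms(3) obtain f where f: "f \<in> P" "f \<noteq> 0" by auto
  from \<open>P \<subset> Q\<close> obtain g where g: "g \<in> Q" "g \<notin> P" by blast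
  have g_carr: "g \<in> carrier R" using ideal.Icarr[OF ideal(2) g(1)] .
  obtain \<phi> where \<phi>: "\<phi> \<noteq> 0" "f * Polynomial.monom 1 C dvd pcompose \<phi> g"
    using polynomial_relation_mod[of "f * Polynomial.monom 1 C" g] f(2) by auto
  from \<phi>(2) obtain q where "pcompose \<phi> g = f \<otimes>\<^bsub>R\<^esub> (Polynomial.monom 1 C * q)"
    unfolding dvd_def mult.assoc monomial_algebra_sel by blast
  then have "pcompose \<phi> g \<in> P"
    using ideal.I_r_closed[OF ideal(1) f(1) monom_conductor_mult_mem] by metis
  then obtain c h where c: "c \<noteq> 0" "h \<in> carrier R" "[:c:] + g * h \<in> Q"
    using relation_with_const_term[OF P g_carr g(2) \<phi>(1)] \<open>P \<subset> Q\<close> by blast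
  have "g \<otimes>\<^bsub>R\<^esub> (h \<otimes>\<^bsub>R\<^esub> [:-1:]) \<in> Q"
    using ideal.I_r_closed[OF ideal(2) g(1)] m_closed[OF c(2) const_mem_carrier] by blast
  then have "([:c:] + g * h) \<oplus>\<^bsub>R\<^esub> (g \<otimes>\<^bsub>R\<^esub> (h \<otimes>\<^bsub>R\<^esub> [:-1:])) \<in> Q"
    using c(3) additive_subgroup.a_closed[OF ideal.axioms(1)[OF ideal(2)]] by blast
  then have "[:c:] \<in> Q" by simp
  with prime_contains_no_const[OF Q c(1)] show False by contradiction
qed

lemma krull_dim_semigroup_ring: "krull_dim R = 1"
proof (rule krull_dim_eq_1[OF nonzero_prime_maximal primeideal_vanishing_at_0])
  have "Polynomial.monom 1 C * Polynomial.monom 1 1 \<in> {p \<in> carrier R. poly.coeff p 0 = 0}"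
    using monom_conductor_mult_mem[of "Polynomial.monom 1 1"] by (auto simp: mult_monom)
  moreover have "Polynomial.monom 1 C * Polynomial.monom 1 1 \<noteq> (0::'k poly)"
    by (simp add: mult_monom)
  ultimately show "{p \<in> carrier R. poly.coeff p 0 = 0} \<noteq> {\<zero>\<^bsub>R\<^esub>}"
    unfolding monomial_algebra_sel by blast
qed auto

section \<open>Homogeneous parameters and generalized graded length\<close>

lemma monom_is_sop:
  assumes "h \<in> generated_semigroup A" "0 < h"
  shows "homogeneous_sop R (monomial_grading A) [Polynomial.monom 1 h]"
proof -
  let ?x = "Polynomial.monom (1::'k) h"
  have x: "?x \<in> carrier R" using assms(1) by (simp add: mem_carrier_iff)
  have "?x \<in> genideal R {?x}" using x by (intro genideal_self') 
  then have "genideal R {?x} \<noteq> {\<zero>\<^bsub>R\<^esub>}" by auto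
  then have "krull_dim (R Quot genideal R {?x}) = 0"
    using nonzero_prime_maximal x by (intro krull_dim_Quot_eq_0 genideal_ideal) auto
  then show ?thesis
    using assms(2) x krull_dim_semigroup_ring
    by (auto simp: homogeneous_sop_def mem_monomial_grading_iff one_enat_def)
qed

text \<open>
  An element of the tail is \<open>t^h\<close> times a multiple of \<open>t^C\<close> in \<open>k[t]\<close>, and every such multiple lies in \<open>R\<close>.
\<close>

lemma graded_tail_subset_genideal_monom:
  assumes "h \<in> generated_semigroup A"
  shows "graded_tail R (monomial_grading A) (C + h) \<subseteq> genideal R {Polynomial.monom 1 h}"
proof
  fix p assume p: "p \<in> graded_tail R (monomial_grading A) (C + h)"
  then have "Polynomial.monom 1 (C + h) dvd p"
    using coeff_graded_tail(2) by (subst monom_1_dvd_iff') auto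
  then obtain q where "p = Polynomial.monom 1 (C + h) * q" by (elim dvdE)
  then have "p = (Polynomial.monom 1 C * q) * Polynomial.monom 1 h"
    using mult_monom[of "1::'k" C 1 h] by (simp add: ac_simps)
  then show "p \<in> genideal R {Polynomial.monom 1 h}"
    using assms monom_conductor_mult_mem
    by (subst genideal_singleton) (auto simp: mem_carrier_iff)
qed

text \<open>
  A system of parameters consists of one element \<open>c t^h\<close>. The case \<open>c = 0\<close> is excluded because
  the zero ideal contains no \<open>t^i\<close>. The witness against a small \<open>n\<close> is \<open>t^(C - 1 + h)\<close>, whose
  quotient by \<open>t^h\<close> has the missing exponent \<open>C - 1\<close>.
\<close>

lemma graded_tail_subset_sop_bound:
  assumes sop: "homogeneous_sop R (monomial_grading A) xs" and "0 < n"
    and sub: "graded_tail R (monomial_grading A) n \<subseteq> genideal R (set xs)"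
    and least: "\<And>h. h \<in> generated_semigroup A \<Longrightarrow> 0 < h \<Longrightarrow> l \<le> h"
  shows "C + l \<le> n"
proof -
  have "length xs = 1"
    using sop krull_dim_semigroup_ring by (simp add: homogeneous_sop_def one_enat_def)
  then obtain x where xs: "xs = [x]" by (auto simp: length_Suc_conv)
  with sop obtain h where h: "0 < h" "x \<in> monomial_grading A h"
    by (auto simp: homogeneous_sop_def)
  then obtain c where x: "x \<in> carrier R" "x = Polynomial.monom c h"
    by (auto simp: mem_monomial_grading_iff)
  have in_ideal: "\<exists>r\<in>carrier R. Polynomial.monom 1 i = r * Polynomial.monom c h"
    if "i \<in> generated_semigroup A" "n \<le> i" for i
    using monom_mem_graded_tail[OF that] sub genideal_singleton[OF x(1)] by (auto simp: xs x(2))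
  have "C + n \<in> generated_semigroup A" using conductor_le_mem[OF gcd] by (simp add: C)
  from in_ideal[OF this] have "c \<noteq> 0" by auto
  with x have hG: "h \<in> generated_semigroup A" by (simp add: mem_carrier_iff)
  have "l \<le> h" using least hG h(1) by blast
  show ?thesis
  proof (cases "C = 0")
    case True
    then have "1 \<in> generated_semigroup A" using conductor_le_mem[OF gcd] by (simp add: C)
    then show ?thesis using least[of 1] \<open>0 < n\<close> True by simp
  next
    case False
    show ?thesis
    proof (rule ccontr)
      assume "\<not> ?thesis"
      with \<open>l \<le> h\<close> have "n \<le> C - 1 + h" by linarith
      moreover have "C - 1 + h \<in> generated_semigroup A"
        using conductor_le_mem[OF gcd, of "C - 1 + h"] h(1) by (simp add: C)
      ultimately obtain r where r: "r \<in> carrier R"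
        "Polynomial.monom 1 (C - 1 + h) = r * Polynomial.monom c h"
        using in_ideal by blast
      from arg_cong[OF r(2), of "\<lambda>p. poly.coeff p (C - 1 + h)"]
      have "poly.coeff r (C - 1) \<noteq> 0" by (auto simp: coeff_monom_mult mult.commute[of r])
      then have "C - 1 \<in> generated_semigroup A" using r(1) by (simp add: mem_carrier_iff)
      then show False using pred_conductor_notin[OF gcd] False by (simp add: C)
    qed
  qed
qed

lemma ggl_semigroup_ring:
  assumes "l \<in> generated_semigroup A" "0 < l"
    and "\<And>h. h \<in> generated_semigroup A \<Longrightarrow> 0 < h \<Longrightarrow> l \<le> h"
  shows "ggl R (monomial_grading A) = C + l"
  unfolding ggl_def
proof (rule Least_equality)
  show "0 < C + l \<and> (\<exists>xs. homogeneous_sop R (monomial_grading A) xs \<and>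
      graded_tail R (monomial_grading A) (C + l) \<subseteq> genideal R (set xs))"
    using assms(2) monom_is_sop[OF assms(1,2)] graded_tail_subset_genideal_monom[OF assms(1)]
    by (intro conjI exI[of _ "[Polynomial.monom 1 l]"]) auto
qed (use graded_tail_subset_sop_bound assms(3) in blast)

end

end

theorem proposition4p4:
  fixes a :: "nat \<Rightarrow> nat" and n C :: nat and H :: "nat set"
    and R :: "'k::field poly ring"
  assumes "1 \<le> n"
    and "0 < a 1"
    and "strict_mono_on {1..n} a"
    and "Gcd (a ` {1..n}) = 1"
    and "H = generated_semigroup (a ` {1..n})"
    and "minimal_generating_set (a ` {1..n}) H"
    and "C = conductor H"
    and "R = monomial_algebra (a ` {1..n})"
  shows "ggl R (monomial_grading (a ` {1..n})) = C + a 1"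
proof -
  have "a 1 \<le> x" if "x \<in> a ` {1..n}" for x
    using that strict_mono_on_leD[OF assms(3), of 1] assms(1) by auto
  then have "a 1 \<le> h" if "h \<in> generated_semigroup (a ` {1..n})" "0 < h" for h
    using generated_semigroup_ge that by blast
  moreover have "a 1 \<in> generated_semigroup (a ` {1..n})"
    using assms(1) by (auto intro: generated_semigroup.incl)
  ultimately show ?thesis
    using ggl_semigroup_ring assms(2,4,5,7,8) by blast
qed

end
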